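(* Let $(\{\omega_{n+1/2}\}_{n\ge 0},\{\alpha_n\}_{n\ge 0})$ be a Jacobi sequence and let $\Gamma_{\omega,\alpha}=(\Gamma(\mathbb{C}),A,B,C)$ be the associated interacting Fock space, with $X=A+B+C$. Suppose that $\Gamma_{\omega,\alpha}$ satisfies the condition (RAC2) but does not satisfy (RAC1). Define a real number $c$ by $$c=\lim_{n\to\infty}\frac{\alpha_n-\alpha_{n-1}}{\sqrt{\omega_{n-1/2}+\omega_{n+1/2}}}.$$ Then for each natural number $m$, $$\lim_{k\to\infty}\left\langle\left(\frac{X-\alpha_k}{\sqrt{\omega_{k+1/2}+\omega_{k-1/2}}}\right)^m\Phi_k,\Phi_k\right\rangle=\int_{\mathbb{R}}x^m\,d\mu_c,$$ where $\mu_c$ is the discrete arcsine distribution with parameter $c$.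
   Context: A Jacobi sequence is a pair $(\{\omega_{n+1/2}\}_{n\ge0},\{\alpha_n\}_{n\ge0})$ where $\omega_{1/2},\omega_{3/2},\omega_{5/2},\dots$ are positive real numbers (labeled by half-integers) and $\alpha_0,\alpha_1,\dots$ are real numbers. The associated interacting Fock space $\Gamma_{\omega,\alpha}=(\Gamma(\mathbb{C}),A,B,C)$ consists of the pre-Hilbert space $\Gamma(\mathbb{C})=\bigoplus_{n=0}^\infty\mathbb{C}\Phi_n$ (algebraic direct sum) with $\langle\Phi_n,\Phi_m\rangle=\delta_{n,m}$, and the linear operators given by $A\Phi_0=0$, $A\Phi_n=\sqrt{\omega_{n-1/2}}\,\Phi_{n-1}$ for $n\ge1$; $B\Phi_n=\alpha_n\Phi_n$; $C\Phi_n=\sqrt{\omega_{n+1/2}}\,\Phi_{n+1}$. A scalar such as $\alpha_k$ in an operator expression denotes that multiple of the identity. Limits of vectors are taken in the norm of the inner product. (RAC1) is the condition that $$\lim_{n\to\infty}\frac{(AC-CA)\Phi_n}{\omega_{n+1/2}+\omega_{n-1/2}}=0\quad\text{and}\quad \lim_{n\to\infty}\frac{(AB-BA)\Phi_n}{\omega_{n+1/2}+\omega_{n-1/2}}=0.$$ (RAC2) is the condition that $$\lim_{n\to\infty}\frac{(AC-CA)\Phi_n}{\omega_{n+1/2}+\omega_{n-1/2}}=0$$ and there exists a real number $r$ satisfying $$\lim_{n\to\infty}\frac{[(AB-BA)-rA]\Phi_n}{\omega_{n+1/2}+\omega_{n-1/2}}=0.$$ For a real number $c\neq0$, define $a_n(c)$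 by the Fourier expansion $\exp\left(i\frac{\sqrt2\sin t}{c}\right)=\sum_{n\in\mathbb{Z}}a_n(c)e^{int}$. The discrete arcsine distribution is the probability measure $\mu_c=\sum_{n\in\mathbb{Z}}|a_n(c)|^2\delta_{cn}$ on $\mathbb{R}$, where $\delta_x$ is the unit point mass at $x$.
   Formalization: The existence of the real limit defining c is assumed, as it does not follow from (RAC2) without (RAC1): for ω_{n+1/2} = 2 + sin(log(n+1)), α_n = n, the quotient oscillates and c is undefined. *)

theory Defs
  imports "HOL-Probability.Probability" "HOL-Library.Poly_Mapping"
begin

section \<open>Interacting Fock spaces\<close>

text \<open>The vector \<open>\<Sum>n. v\<^sub>n \<Phi>\<^sub>n\<close> is the finitely supported sequence \<open>v\<close>. The library has no class for
  complex inner product spaces, so scaling, inner product and norm are given here.\<close>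

type_synonym fock = "nat \<Rightarrow>\<^sub>0 complex"

abbreviation Phi :: "nat \<Rightarrow> fock" where
  "Phi n \<equiv> Poly_Mapping.single n 1"

definition fock_scale :: "complex \<Rightarrow> fock \<Rightarrow> fock" where
  "fock_scale z v = Poly_Mapping.map ((*) z) v"

definition fock_inner :: "fock \<Rightarrow> fock \<Rightarrow> complex" where
  "fock_inner u v = (\<Sum>n\<in>Poly_Mapping.keys u \<inter> Poly_Mapping.keys v. Poly_Mapping.lookup u n * cnj (Poly_Mapping.lookup v n))"

definition fock_norm :: "fock \<Rightarrow> real" where
  "fock_norm v = sqrt (Re (fock_inner v v))"

definition fock_tendsto :: "(nat \<Rightarrow> fock) \<Rightarrow> fock \<Rightarrow> bool" where
  "fock_tendsto v l \<longleftrightarrow> (\<lambda>n. fock_norm (v n - l)) \<longlonglongrightarrow> 0"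

definition linear_extension :: "(nat \<Rightarrow> fock) \<Rightarrow> fock \<Rightarrow> fock" where
  "linear_extension b v = (\<Sum>n\<in>Poly_Mapping.keys v. fock_scale (Poly_Mapping.lookup v n) (b n))"

text \<open>Half-integer labels are shifted down: \<open>\<omega> n\<close> stands for \<open>\<omega>\<^sub>n\<^sub>+\<^sub>1\<^sub>/\<^sub>2\<close>, hence \<open>\<omega> (n - 1)\<close> stands for
  \<open>\<omega>\<^sub>n\<^sub>-\<^sub>1\<^sub>/\<^sub>2\<close> whenever \<open>n \<ge> 1\<close>. Where \<open>\<omega> (n - 1)\<close> occurs inside a limit in \<open>n\<close>, its value at \<open>n = 0\<close>,
  to which nothing corresponds, is irrelevant.\<close>

definition jacobi_sequence :: "(nat \<Rightarrow> real) \<Rightarrow> (nat \<Rightarrow> real) \<Rightarrow> bool" where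
  "jacobi_sequence \<omega> \<alpha> \<longleftrightarrow> (\<forall>n. \<omega> n > 0)"

definition fock_A :: "(nat \<Rightarrow> real) \<Rightarrow> fock \<Rightarrow> fock" where
  "fock_A \<omega> = linear_extension
     (\<lambda>n. if n = 0 then 0 else fock_scale (of_real (sqrt (\<omega> (n - 1)))) (Phi (n - 1)))"

definition fock_B :: "(nat \<Rightarrow> real) \<Rightarrow> fock \<Rightarrow> fock" where
  "fock_B \<alpha> = linear_extension (\<lambda>n. fock_scale (of_real (\<alpha> n)) (Phi n))"

definition fock_C :: "(nat \<Rightarrow> real) \<Rightarrow> fock \<Rightarrow> fock" where
  "fock_C \<omega> = linear_extension (\<lambda>n. fock_scale (of_real (sqrt (\<omega> n))) (Phi (n + 1)))"

definition fock_X :: "(nat \<Rightarrow> real) \<Rightarrow> (nat \<Rightarrow> real) \<Rightarrow> fock \<Rightarrow> fock" where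
  "fock_X \<omega> \<alpha> v = fock_A \<omega> v + fock_B \<alpha> v + fock_C \<omega> v"

definition commutator :: "(fock \<Rightarrow> fock) \<Rightarrow> (fock \<Rightarrow> fock) \<Rightarrow> fock \<Rightarrow> fock" where
  "commutator S T v = S (T v) - T (S v)"

definition RAC1 :: "(nat \<Rightarrow> real) \<Rightarrow> (nat \<Rightarrow> real) \<Rightarrow> bool" where
  "RAC1 \<omega> \<alpha> \<longleftrightarrow>
     fock_tendsto (\<lambda>n. fock_scale (of_real (1 / (\<omega> n + \<omega> (n - 1))))
       (commutator (fock_A \<omega>) (fock_C \<omega>) (Phi n))) 0 \<and>
     fock_tendsto (\<lambda>n. fock_scale (of_real (1 / (\<omega> n + \<omega> (n - 1))))
       (commutator (fock_A \<omega>) (fock_B \<alpha>) (Phi n))) 0"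

definition RAC2 :: "(nat \<Rightarrow> real) \<Rightarrow> (nat \<Rightarrow> real) \<Rightarrow> bool" where
  "RAC2 \<omega> \<alpha> \<longleftrightarrow>
     fock_tendsto (\<lambda>n. fock_scale (of_real (1 / (\<omega> n + \<omega> (n - 1))))
       (commutator (fock_A \<omega>) (fock_C \<omega>) (Phi n))) 0 \<and>
     (\<exists>r::real. fock_tendsto (\<lambda>n. fock_scale (of_real (1 / (\<omega> n + \<omega> (n - 1))))
       (commutator (fock_A \<omega>) (fock_B \<alpha>) (Phi n) - fock_scale (of_real r) (fock_A \<omega> (Phi n)))) 0)"

text \<open>The operator \<open>(X - \<alpha>\<^sub>k) / sqrt (\<omega>\<^sub>k\<^sub>+\<^sub>1\<^sub>/\<^sub>2 + \<omega>\<^sub>k\<^sub>-\<^sub>1\<^sub>/\<^sub>2)\<close>.\<close>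

definition normalized_X :: "(nat \<Rightarrow> real) \<Rightarrow> (nat \<Rightarrow> real) \<Rightarrow> nat \<Rightarrow> fock \<Rightarrow> fock" where
  "normalized_X \<omega> \<alpha> k v =
     fock_scale (of_real (1 / sqrt (\<omega> k + \<omega> (k - 1))))
       (fock_X \<omega> \<alpha> v - fock_scale (of_real (\<alpha> k)) v)"

lemma lookup_fock_scale [simp]: "Poly_Mapping.lookup (fock_scale z v) n = z * Poly_Mapping.lookup v n"
  by (simp add: fock_scale_def Poly_Mapping.map.rep_eq when_def)

lemma fock_scale_one [simp]: "fock_scale 1 v = v"
  by (rule poly_mapping_eqI) simp

lemma linear_extension_Phi [simp]: "linear_extension b (Phi n) = b n"
  by (simp add: linear_extension_def)

lemma linear_extension_add: "linear_extension b (u + v) = linear_extension b u + linear_extension b v"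
proof (rule poly_mapping_eqI)
  fix k
  have ext: "Poly_Mapping.lookup (linear_extension b w) k = (\<Sum>n\<in>S. Poly_Mapping.lookup w n * Poly_Mapping.lookup (b n) k)"
    if "finite S" "Poly_Mapping.keys w \<subseteq> S" for w S
    unfolding linear_extension_def lookup_sum lookup_fock_scale
    by (rule sum.mono_neutral_left) (use that in \<open>auto simp: in_keys_iff\<close>)
  show "Poly_Mapping.lookup (linear_extension b (u + v)) k = Poly_Mapping.lookup (linear_extension b u + linear_extension b v) k"
    using keys_add[of u v]
    by (simp add: ext[of "Poly_Mapping.keys u \<union> Poly_Mapping.keys v"] lookup_add sum.distrib[symmetric] algebra_simps)
qed

lemma linear_extension_scale: "linear_extension b (fock_scale z v) = fock_scale z (linear_extension b v)"
proof (cases "z = 0")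
  case True
  then have "fock_scale z w = 0" for w
    by (intro poly_mapping_eqI) simp
  then show ?thesis by (simp add: linear_extension_def)
next
  case False
  then have "Poly_Mapping.keys (fock_scale z v) = Poly_Mapping.keys v"
    by (auto simp: in_keys_iff)
  then show ?thesis
    by (intro poly_mapping_eqI)
       (simp add: linear_extension_def lookup_sum sum_distrib_left mult.assoc)
qed

lemma fock_inner_Phi: "fock_inner (Phi n) (Phi m) = (if n = m then 1 else 0)"
  by (simp add: fock_inner_def)

lemma fock_norm_scale_Phi [simp]: "fock_norm (fock_scale z (Phi n)) = cmod z"
proof -
  have "Poly_Mapping.keys (fock_scale z (Phi n)) = (if z = 0 then {} else {n})"
    by (auto simp: in_keys_iff lookup_single when_def split: if_splits intro!: poly_mapping_eqI)
  then show ?thesis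
    by (auto simp: fock_norm_def fock_inner_def complex_mult_cnj cmod_def power2_eq_square)
qed


lemma fock_A_Phi: "fock_A \<omega> (Phi 0) = 0"
    "fock_A \<omega> (Phi (Suc n)) = fock_scale (of_real (sqrt (\<omega> n))) (Phi n)"
  and fock_B_Phi: "fock_B \<alpha> (Phi n) = fock_scale (of_real (\<alpha> n)) (Phi n)"
  and fock_C_Phi: "fock_C \<omega> (Phi n) = fock_scale (of_real (sqrt (\<omega> n))) (Phi (Suc n))"
  by (simp_all add: fock_A_def fock_B_def fock_C_def del: single_one)

text \<open>Under the hypotheses of the limit theorem the parameter of the arcsine distribution is not zero.\<close>

lemma arcsine_parameter_nonzero:
  assumes "jacobi_sequence \<omega> \<alpha>" "RAC2 \<omega> \<alpha>" "\<not> RAC1 \<omega> \<alpha>"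
    and lim: "(\<lambda>n. (\<alpha> n - \<alpha> (n - 1)) / sqrt (\<omega> (n - 1) + \<omega> n)) \<longlonglongrightarrow> c"
  shows "c \<noteq> 0"
proof
  assume c: "c = 0"
  have pos: "\<omega> n > 0" for n
    using assms(1) by (simp add: jacobi_sequence_def)
  have "fock_tendsto (\<lambda>n. fock_scale (of_real (1 / (\<omega> n + \<omega> (n - 1))))
      (commutator (fock_A \<omega>) (fock_B \<alpha>) (Phi n))) 0"
    unfolding fock_tendsto_def
  proof (rule Lim_null_comparison)
    show "(\<lambda>n. \<bar>(\<alpha> n - \<alpha> (n - 1)) / sqrt (\<omega> (n - 1) + \<omega> n)\<bar>) \<longlonglongrightarrow> 0"
      by (rule tendsto_rabs_zero) (use lim c in simp)
    show "\<forall>\<^sub>F n in sequentially.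
        norm (fock_norm (fock_scale (of_real (1 / (\<omega> n + \<omega> (n - 1))))
          (commutator (fock_A \<omega>) (fock_B \<alpha>) (Phi n)) - 0))
        \<le> \<bar>(\<alpha> n - \<alpha> (n - 1)) / sqrt (\<omega> (n - 1) + \<omega> n)\<bar>"
    proof (rule eventually_sequentiallyI[of 1])
      fix n :: nat
      assume "1 \<le> n"
      then obtain m where n: "n = Suc m"
        by (cases n) auto
      define s where "s = sqrt (\<omega> m + \<omega> n)"
      have s: "s > 0" "s * s = \<omega> m + \<omega> n" "sqrt (\<omega> m) \<le> s"
        using pos[of m] pos[of n] by (simp_all add: s_def)
      have "fock_scale (of_real (1 / (\<omega> n + \<omega> (n - 1))))
            (commutator (fock_A \<omega>) (fock_B \<alpha>) (Phi n)) =
          fock_scale (of_real ((\<alpha> n - \<alpha> m) * sqrt (\<omega> m) / (s * s))) (Phi m)"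
        unfolding commutator_def fock_B_Phi n fock_A_Phi
        by (rule poly_mapping_eqI)
           (simp add: fock_A_def fock_B_def linear_extension_scale lookup_minus s n algebra_simps
             diff_divide_distrib add_divide_distrib)
      then have "norm (fock_norm (fock_scale (of_real (1 / (\<omega> n + \<omega> (n - 1))))
            (commutator (fock_A \<omega>) (fock_B \<alpha>) (Phi n)) - 0)) =
          \<bar>\<alpha> n - \<alpha> m\<bar> / s * (sqrt (\<omega> m) / s)"
        using s(1) pos[of m] by (simp add: abs_mult del: of_real_mult of_real_divide of_real_diff)
      also have "\<dots> \<le> \<bar>\<alpha> n - \<alpha> m\<bar> / s * 1"
        using s by (intro mult_left_mono) auto
      finally show "norm (fock_norm (fock_scale (of_real (1 / (\<omega> n + \<omega> (n - 1))))
            (commutator (fock_A \<omega>) (fock_B \<alpha>) (Phi n)) - 0))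
          \<le> \<bar>(\<alpha> n - \<alpha> (n - 1)) / sqrt (\<omega> (n - 1) + \<omega> n)\<bar>"
        using s by (simp add: n s_def abs_divide)
    qed
  qed
  then show False
    using assms(2,3) by (simp add: RAC1_def RAC2_def)
qed


section \<open>The discrete arcsine distribution\<close>

text \<open>The coefficients \<open>a\<^sub>n(c)\<close>. That they exist and are unique is shown in \<open>arcsine_coeff_expansion\<close> and
  \<open>arcsine_coeff_unique\<close>.\<close>

definition arcsine_coeff :: "real \<Rightarrow> int \<Rightarrow> complex" where
  "arcsine_coeff c = (THE a. \<forall>t::real.
     ((\<lambda>n. a n * exp (\<i> * of_int n * of_real t)) has_sum
        exp (\<i> * of_real (sqrt 2 * sin t / c))) UNIV)"

text \<open>The measure \<open>\<Sum>n. |a\<^sub>n(c)|\<^sup>2 \<delta>\<^sub>c\<^sub>n\<close>, as the image under \<open>n \<mapsto> c n\<close> of the measure on \<open>\<int>\<close> with weights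
  \<open>|a\<^sub>n(c)|\<^sup>2\<close>; see \<open>emeasure_discrete_arcsine\<close>.\<close>

definition discrete_arcsine :: "real \<Rightarrow> real measure" where
  "discrete_arcsine c =
     distr (density (count_space UNIV) (\<lambda>n::int. ennreal ((cmod (arcsine_coeff c n))\<^sup>2)))
       borel (\<lambda>n. c * of_int n)"

lemma emeasure_discrete_arcsine:
  assumes "E \<in> sets borel"
  shows "emeasure (discrete_arcsine c) E =
    (\<integral>\<^sup>+n. ennreal ((cmod (arcsine_coeff c n))\<^sup>2) * emeasure (return borel (c * of_int n)) E \<partial>count_space UNIV)"
  using assms
  by (auto simp: discrete_arcsine_def emeasure_distr emeasure_density indicator_def
      intro!: nn_integral_cong)

subsection \<open>Well-definedness\<close>

lemma exp_has_sum:
  fixes x :: "'a :: {real_normed_field, banach}"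
  shows "((\<lambda>n. x ^ n / fact n) has_sum exp x) UNIV"
    and "(\<lambda>n. norm (x ^ n / fact n)) summable_on UNIV"
proof -
  have eq: "x ^ n /\<^sub>R fact n = x ^ n / fact n" for n
    by (simp add: scaleR_conv_of_real field_simps)
  have s: "summable (\<lambda>n. norm (x ^ n / fact n))"
    using summable_norm_exp[of x] unfolding eq .
  show "((\<lambda>n. x ^ n / fact n) has_sum exp x) UNIV"
    using norm_summable_imp_has_sum[OF s] exp_converges[of x] unfolding eq .
  show "(\<lambda>n. norm (x ^ n / fact n)) summable_on UNIV"
    by (rule norm_summable_imp_summable_on) (use s in simp)
qed

lemma has_sum_mult:
  fixes f :: "'a \<Rightarrow> 'c :: {real_normed_field, banach}" and g :: "'b \<Rightarrow> 'c"
  assumes f: "(f has_sum S) UNIV" "(\<lambda>x. norm (f x)) summable_on UNIV"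
    and g: "(g has_sum T) UNIV" "(\<lambda>x. norm (g x)) summable_on UNIV"
  shows "((\<lambda>(x, y). f x * g y) has_sum S * T) UNIV"
    and "(\<lambda>(x, y). norm (f x * g y)) summable_on UNIV"
proof -
  have "(\<lambda>(x, y). norm (f x * g y)) summable_on UNIV \<times> UNIV"
  proof (rule summable_on_SigmaI)
    show "((\<lambda>y. case (x, y) of (x, y) \<Rightarrow> norm (f x * g y)) has_sum
        norm (f x) * infsum (\<lambda>y. norm (g y)) UNIV) UNIV" for x
      using has_sum_cmult_right[OF has_sum_infsum[OF g(2)]] by (simp add: norm_mult)
    show "(\<lambda>x. norm (f x) * infsum (\<lambda>y. norm (g y)) UNIV) summable_on UNIV"
      by (intro summable_on_cmult_left f)
  qed auto
  then show n: "(\<lambda>(x, y). norm (f x * g y)) summable_on UNIV"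
    by simp
  then have n': "(\<lambda>p. norm ((\<lambda>(x, y). f x * g y) p)) summable_on UNIV \<times> UNIV"
    by (simp add: case_prod_unfold)
  have "((\<lambda>(x, y). f x * g y) has_sum S * T) (UNIV \<times> UNIV)"
  proof (rule has_sum_SigmaI)
    show "((\<lambda>y. case (x, y) of (x, y) \<Rightarrow> f x * g y) has_sum f x * T) UNIV" for x
      using has_sum_cmult_right[OF g(1)] by simp
    show "((\<lambda>x. f x * T) has_sum S * T) UNIV"
      by (intro has_sum_cmult_left f)
    show "(\<lambda>(x, y). f x * g y) summable_on UNIV \<times> UNIV"
      by (rule Infinite_Sum.abs_summable_summable[OF n'])
  qed
  then show "((\<lambda>(x, y). f x * g y) has_sum S * T) UNIV"
    by simp
qed

lemma has_sum_fibres: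
  fixes f :: "'a \<Rightarrow> 'c :: banach"
  assumes "(f has_sum S) UNIV" "(\<lambda>x. norm (f x)) summable_on UNIV"
  shows "((\<lambda>n. infsum f {x. \<phi> x = n}) has_sum S) UNIV"
proof (rule has_sum_SigmaD)
  have "bij_betw snd (Sigma UNIV (\<lambda>n. {x. \<phi> x = n})) UNIV"
    by (rule bij_betwI[where g = "\<lambda>x. (\<phi> x, x)"]) auto
  from has_sum_reindex_bij_betw[OF this, of f S]
  show "((\<lambda>p. f (snd p)) has_sum S) (Sigma UNIV (\<lambda>n. {x. \<phi> x = n}))"
    using assms(1) by simp
  show "((\<lambda>y. f (snd (n, y))) has_sum infsum f {x. \<phi> x = n}) {x. \<phi> x = n}" for n
  proof -
    have "f summable_on {x. \<phi> x = n}"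
      by (rule Infinite_Sum.abs_summable_summable) (rule summable_on_subset_banach[OF assms(2)], simp)
    then show ?thesis by simp
  qed
qed

lemma fourier_regroup:
  fixes g :: "'a \<Rightarrow> complex" and \<phi> :: "'a \<Rightarrow> int"
  assumes "((\<lambda>p. g p * exp (\<i> * of_int (\<phi> p) * of_real t)) has_sum S) UNIV"
    and "(\<lambda>p. norm (g p)) summable_on UNIV"
  shows "((\<lambda>n. infsum g {p. \<phi> p = n} * exp (\<i> * of_int n * of_real t)) has_sum S) UNIV"
proof -
  let ?h = "\<lambda>p. g p * exp (\<i> * of_int (\<phi> p) * of_real t)"
  have "(\<lambda>p. norm (?h p)) summable_on UNIV"
    using assms(2) by (simp add: norm_mult)
  from has_sum_fibres[OF assms(1) this, of \<phi>]
  have "((\<lambda>n. infsum ?h {p. \<phi> p = n}) has_sum S) UNIV" .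
  moreover have "infsum ?h {p. \<phi> p = n} = infsum g {p. \<phi> p = n} * exp (\<i> * of_int n * of_real t)" for n
    by (subst infsum_cmult_left'[symmetric]) (auto intro: infsum_cong)
  ultimately show ?thesis by simp
qed

lemma has_sum_finite_sum:
  fixes f :: "'i \<Rightarrow> 'a \<Rightarrow> 'c :: real_normed_vector"
  assumes "finite I" "\<And>i. i \<in> I \<Longrightarrow> (f i has_sum S i) A"
  shows "((\<lambda>x. \<Sum>i\<in>I. f i x) has_sum (\<Sum>i\<in>I. S i)) A"
  using assms by (induction I rule: finite_induct) (auto intro: has_sum_add)

lemma fourier_coeff_zero:
  fixes d :: "int \<Rightarrow> complex"
  assumes d: "\<And>t::real. ((\<lambda>n. d n * exp (\<i> * of_int n * of_real t)) has_sum 0) UNIV"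
  shows "d m = 0"
proof (rule ccontr)
  assume "d m \<noteq> 0"
  define e where "e = norm (d m)"
  have e: "e > 0" using \<open>d m \<noteq> 0\<close> by (simp add: e_def)
  have "d summable_on UNIV"
    using d[of 0] by (auto simp: summable_on_def)
  then have ns: "(\<lambda>n. norm (d n)) summable_on UNIV"
    using summable_on_iff_abs_summable_on_complex by blast
  define T where "T = infsum (\<lambda>n. norm (d n)) UNIV"
  have T: "((\<lambda>n. norm (d n)) has_sum T) UNIV"
    using ns by (simp add: T_def)
  obtain F0 where F0: "finite F0" "dist (sum (\<lambda>n. norm (d n)) F0) T \<le> e / 2"
    using has_sum_finite_approximation[OF T, of "e/2"] e by auto
  define F where "F = insert m F0"
  have F: "finite F" "m \<in> F" using F0 by (auto simp: F_def)
  have "T - sum (\<lambda>n. norm (d n)) F0 \<le> e / 2"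
    using F0(2) unfolding dist_real_def by linarith
  moreover have "sum (\<lambda>n. norm (d n)) F0 \<le> sum (\<lambda>n. norm (d n)) F"
    by (rule sum_mono2) (use F in \<open>auto simp: F_def\<close>)
  ultimately have TF: "T - sum (\<lambda>n. norm (d n)) F < e"
    using e by linarith
  define N where "N = nat (Max ((\<lambda>n. \<bar>n - m\<bar>) ` F)) + 1"
  have N: "\<bar>n - m\<bar> < int N" if "n \<in> F" for n
  proof -
    have "\<bar>n - m\<bar> \<le> Max ((\<lambda>n. \<bar>n - m\<bar>) ` F)"
      using that F by (intro Max_ge) auto
    moreover from this have "0 \<le> Max ((\<lambda>n. \<bar>n - m\<bar>) ` F)"
      by (rule order_trans[OF abs_ge_zero])
    ultimately show ?thesis by (simp add: N_def)
  qed
  have N0: "N > 0" by (simp add: N_def)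
  define h where "h n = (if int N dvd n - m then d n else 0)" for n
  have avg: "(\<Sum>j<N. exp (\<i> * of_int (n - m) * of_real (2 * pi * j / N))) =
      (if int N dvd n - m then of_nat N else (0::complex))" for n
  proof -
    define q where "q = exp (\<i> * of_int (n - m) * of_real (2 * pi / N))"
    have q: "exp (\<i> * of_int (n - m) * of_real (2 * pi * j / N)) = q ^ j" for j :: nat
      by (simp add: q_def exp_of_nat_mult[symmetric] mult_ac)
    have "q ^ N = exp (\<i> * of_int (n - m) * of_real (2 * pi))"
      using q[of N] N0 by simp
    also have "\<dots> = 1"
      by (auto simp: exp_eq_1 intro!: exI[of _ "n - m"])
    finally have qN: "q ^ N = 1" .
    show ?thesis
    proof (cases "int N dvd n - m")
      case True
      then obtain l where l: "n - m = int N * l" by blast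
      have "real_of_int (n - m) * (2 * pi / N) = 2 * pi * l"
        using N0 by (simp add: l)
      moreover have "\<i> * of_int (n - m) * complex_of_real (2 * pi / N) =
          \<i> * of_real (real_of_int (n - m) * (2 * pi / N))"
        by simp
      ultimately have "q = exp (\<i> * of_real (2 * pi * l))"
        unfolding q_def by simp
      also have "\<dots> = 1"
        by (auto simp: exp_eq_1)
      finally show ?thesis using True by (simp only: q) simp
    next
      case False
      have "q \<noteq> 1"
      proof
        assume "q = 1"
        then obtain l :: int where l: "real_of_int (n - m) * (2 * pi / N) = of_int (2 * l) * pi"
          unfolding q_def exp_eq_1 by auto
        then have "(2 * pi) * real_of_int (n - m) = (2 * pi) * of_int (int N * l)"
          using N0 by (simp add: field_simps)
        then have "real_of_int (n - m) = of_int (int N * l)"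
          by (simp only: mult_cancel_left) simp
        then have "n - m = int N * l"
          by (simp only: of_int_eq_iff)
        with False show False by simp
      qed
      then show ?thesis
        using False qN by (simp only: q) (simp add: sum_gp_strict)
    qed
  qed
  have "((\<lambda>n. \<Sum>j<N. exp (- \<i> * of_int m * of_real (2 * pi * j / N)) *
      (d n * exp (\<i> * of_int n * of_real (2 * pi * j / N)))) has_sum
      (\<Sum>j<N. exp (- \<i> * of_int m * of_real (2 * pi * j / N)) * 0)) UNIV"
    by (intro has_sum_finite_sum finite_lessThan has_sum_cmult_right d)
  moreover have "(\<Sum>j<N. exp (- \<i> * of_int m * of_real (2 * pi * j / N)) *
      (d n * exp (\<i> * of_int n * of_real (2 * pi * j / N)))) = of_nat N * h n" for n
  proof -
    have "exp (- \<i> * of_int m * of_real (2 * pi * j / N)) *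
      (d n * exp (\<i> * of_int n * of_real (2 * pi * j / N))) =
      d n * exp (\<i> * of_int (n - m) * of_real (2 * pi * j / N))" for j
    proof -
      have "exp (\<i> * of_int (n - m) * of_real (2 * pi * j / N)) =
          exp (- \<i> * of_int m * of_real (2 * pi * j / N)) * exp (\<i> * of_int n * of_real (2 * pi * j / N))"
        by (subst exp_add[symmetric], rule arg_cong[of _ _ exp])
           (simp only: of_int_diff ring_distribs, simp)
      then show ?thesis
        by (simp only: mult_ac)
    qed
    then show ?thesis
      by (simp only: sum_distrib_left[symmetric] avg h_def) simp
  qed
  ultimately have "((\<lambda>n. of_nat N * h n) has_sum 0) UNIV"
    by simp
  then have h0: "(h has_sum 0) UNIV"
    using N0 by (subst (asm) has_sum_cmult_right_iff) auto
  have "sum h F = (\<Sum>n\<in>{m}. h n)"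
  proof (rule sum.mono_neutral_right)
    show "\<forall>n\<in>F - {m}. h n = 0"
    proof
      fix n assume n: "n \<in> F - {m}"
      then have "\<not> int N dvd n - m"
        using N[of n] dvd_imp_le_int[of "n - m" "int N"] by auto
      then show "h n = 0" by (simp add: h_def)
    qed
  qed (use F in auto)
  then have hF: "(h has_sum d m) F"
    using has_sum_finite[OF F(1), of h] by (simp add: h_def)
  have hc: "(h has_sum (0 - d m)) (UNIV - F)"
    by (rule has_sum_Diff[OF h0 hF]) simp
  have nF: "((\<lambda>n. norm (d n)) has_sum (T - sum (\<lambda>n. norm (d n)) F)) (UNIV - F)"
    by (rule has_sum_Diff[OF T has_sum_finite[OF F(1)]]) simp
  have nh: "(\<lambda>n. norm (h n)) summable_on (UNIV - F)"
    by (rule summable_on_comparison_test[OF has_sum_imp_summable[OF nF]]) (simp_all add: h_def)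
  have "norm (0 - d m) \<le> infsum (\<lambda>n. norm (h n)) (UNIV - F)"
    by (rule norm_has_sum_bound[OF has_sum_infsum[OF nh] hc])
  also have "\<dots> \<le> T - sum (\<lambda>n. norm (d n)) F"
    by (rule has_sum_mono[OF has_sum_infsum[OF nh] nF]) (simp add: h_def)
  finally have "norm (d m) \<le> T - sum (\<lambda>n. norm (d n)) F"
    by simp
  with TF show False by (simp add: e_def)
qed

lemma fourier_coeff_unique:
  fixes a b :: "int \<Rightarrow> complex"
  assumes "\<And>t::real. ((\<lambda>n. a n * exp (\<i> * of_int n * of_real t)) has_sum f t) UNIV"
    and "\<And>t::real. ((\<lambda>n. b n * exp (\<i> * of_int n * of_real t)) has_sum f t) UNIV"
  shows "a = b"
proof
  fix m
  have "((\<lambda>n. (a n - b n) * exp (\<i> * of_int n * of_real t)) has_sum 0) UNIV" for t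
    using has_sum_add[OF assms(1)[of t] has_sum_cmult_right[OF assms(2)[of t], of "- 1"]]
    by (simp add: algebra_simps)
  from fourier_coeff_zero[OF this, of m] show "a m = b m" by simp
qed

lemma arcsine_coeff_exists:
  "\<exists>a. (\<forall>t::real. ((\<lambda>n. a n * exp (\<i> * of_int n * of_real t)) has_sum
      exp (\<i> * of_real (sqrt 2 * sin t / c))) UNIV) \<and>
    (\<lambda>n. exp \<bar>real_of_int n\<bar> * cmod (a n)) summable_on UNIV"
proof -
  define z where "z = 1 / (sqrt 2 * c)"
  define u v where "u = (\<lambda>j. of_real z ^ j / fact j :: complex)"
    and "v = (\<lambda>k. (- of_real z) ^ k / fact k :: complex)"
  define g where "g = (\<lambda>(j, k). u j * v k)"
  define \<phi> where "\<phi> = (\<lambda>(j, k). int j - int k)"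
  define a where "a n = infsum g {p. \<phi> p = n}" for n
  have u: "(u has_sum exp (of_real z)) UNIV" "(\<lambda>j. norm (u j)) summable_on UNIV"
    unfolding u_def by (rule exp_has_sum)+
  have v: "(v has_sum exp (- of_real z)) UNIV" "(\<lambda>j. norm (v j)) summable_on UNIV"
    unfolding v_def by (rule exp_has_sum)+
  have ng: "(\<lambda>p. norm (g p)) summable_on UNIV"
    using has_sum_mult(2)[OF u v] by (simp add: g_def case_prod_unfold)
  have "((\<lambda>n. a n * exp (\<i> * of_int n * of_real t)) has_sum
      exp (\<i> * of_real (sqrt 2 * sin t / c))) UNIV" for t :: real
    unfolding a_def
  proof (rule fourier_regroup[OF _ ng])
    let ?x = "of_real z * exp (\<i> * of_real t)" and ?y = "- of_real z * exp (- (\<i> * of_real t))"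
    have "((\<lambda>(j, k). (?x ^ j / fact j) * (?y ^ k / fact k)) has_sum exp ?x * exp ?y) UNIV"
      by (intro has_sum_mult exp_has_sum)
    moreover have "exp ?x * exp ?y = exp (\<i> * of_real (sqrt 2 * sin t / c))"
    proof -
      have "?x + ?y = of_real z * (2 * \<i> * sin (of_real t))"
        by (simp add: sin_exp_eq field_simps)
      also have "\<dots> = \<i> * of_real (z * 2 * sin t)"
        by (simp flip: sin_of_real)
      also have "z * 2 * sin t = sqrt 2 * sin t / c"
      proof -
        have "2 / sqrt 2 = sqrt 2" by (rule real_div_sqrt) simp
        then have "z * 2 = sqrt 2 / c" by (simp add: z_def divide_simps)
        then show ?thesis by simp
      qed
      finally show ?thesis by (simp flip: exp_add)
    qed
    moreover have "(?x ^ j / fact j) * (?y ^ k / fact k) =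
        g (j, k) * exp (\<i> * of_int (\<phi> (j, k)) * of_real t)" for j k
    proof -
      have "exp (\<i> * of_int (\<phi> (j, k)) * of_real t) =
          exp (of_nat j * (\<i> * of_real t) + of_nat k * (- (\<i> * of_real t)))"
        by (simp add: \<phi>_def algebra_simps)
      also have "\<dots> = exp (\<i> * of_real t) ^ j * exp (- (\<i> * of_real t)) ^ k"
        by (simp only: exp_add exp_of_nat_mult)
      finally show ?thesis
        by (simp only: g_def u_def v_def power_mult_distrib prod.case) (simp add: mult_ac)
    qed
    ultimately show "((\<lambda>p. g p * exp (\<i> * of_int (\<phi> p) * of_real t)) has_sum
        exp (\<i> * of_real (sqrt 2 * sin t / c))) UNIV"
      by (simp add: case_prod_unfold)
  qed
  moreover have "(\<lambda>n. exp \<bar>real_of_int n\<bar> * cmod (a n)) summable_on UNIV"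
  proof -
    define y where "y = exp 1 * \<bar>z\<bar>"
    define G where "G = (\<lambda>(j, k). (y ^ j / fact j) * (y ^ k / fact k))"
    have y: "y \<ge> 0" by (simp add: y_def)
    have G0: "G p \<ge> 0" for p
      using y by (auto simp: G_def split: prod.split)
    have G: "(G has_sum exp y * exp y) UNIV"
      unfolding G_def by (intro has_sum_mult exp_has_sum)
    then have sG: "G summable_on UNIV"
      by (auto simp: summable_on_def)
    then have "((\<lambda>n. infsum G {p. \<phi> p = n}) has_sum exp y * exp y) UNIV"
      by (intro has_sum_fibres G) (use G0 in simp)
    then have "(\<lambda>n. infsum G {p. \<phi> p = n}) summable_on UNIV"
      by (auto simp: summable_on_def)
    then show ?thesis
    proof (rule summable_on_comparison_test)
      fix n :: int
      have le: "exp \<bar>real_of_int n\<bar> * cmod (g p) \<le> G p" if "\<phi> p = n" for p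
      proof -
        obtain j k where p: "p = (j, k)" by force
        have "\<bar>real_of_int n\<bar> \<le> real (j + k)"
          using that by (auto simp: p \<phi>_def)
        then have "exp \<bar>real_of_int n\<bar> \<le> exp (real (j + k))" by simp
        also have "\<dots> = exp 1 ^ j * exp 1 ^ k"
          by (simp add: exp_add flip: exp_of_nat_mult)
        finally have "exp \<bar>real_of_int n\<bar> * cmod (g p) \<le> exp 1 ^ j * exp 1 ^ k * cmod (g p)"
          by (intro mult_right_mono) auto
        also have "\<dots> = G p"
          by (simp add: p g_def G_def u_def v_def y_def norm_mult norm_divide norm_power power_mult_distrib)
        finally show ?thesis .
      qed
      have s: "(\<lambda>p. norm (g p)) summable_on {p. \<phi> p = n}" "G summable_on {p. \<phi> p = n}"
        by (auto intro: summable_on_subset_banach ng sG)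
      have "exp \<bar>real_of_int n\<bar> * cmod (a n) \<le> exp \<bar>real_of_int n\<bar> * infsum (\<lambda>p. norm (g p)) {p. \<phi> p = n}"
        unfolding a_def by (intro mult_left_mono Infinite_Sum.norm_infsum_bound s) auto
      also have "\<dots> = infsum (\<lambda>p. exp \<bar>real_of_int n\<bar> * norm (g p)) {p. \<phi> p = n}"
        by (rule infsum_cmult_right'[symmetric])
      also have "\<dots> \<le> infsum G {p. \<phi> p = n}"
        by (intro infsum_mono summable_on_cmult_right s) (use le in auto)
      finally show "exp \<bar>real_of_int n\<bar> * cmod (a n) \<le> infsum G {p. \<phi> p = n}" .
    qed auto
  qed
  ultimately show ?thesis by blast
qed

lemma arcsine_coeff_eqI:
  assumes "\<And>t::real. ((\<lambda>n. a n * exp (\<i> * of_int n * of_real t)) has_sum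
      exp (\<i> * of_real (sqrt 2 * sin t / c))) UNIV"
  shows "arcsine_coeff c = a"
  unfolding arcsine_coeff_def
  by (rule the_equality) (use assms in \<open>auto intro!: fourier_coeff_unique\<close>)

lemma arcsine_coeff_expansion:
  "((\<lambda>n. arcsine_coeff c n * exp (\<i> * of_int n * of_real t)) has_sum
      exp (\<i> * of_real (sqrt 2 * sin t / c))) UNIV"
  using arcsine_coeff_exists[of c] arcsine_coeff_eqI[of _ c] by metis

lemma arcsine_coeff_summable:
  "(\<lambda>n. exp \<bar>real_of_int n\<bar> * cmod (arcsine_coeff c n)) summable_on UNIV"
  using arcsine_coeff_exists[of c] arcsine_coeff_eqI[of _ c] by metis

lemma arcsine_coeff_parseval:
  "((\<lambda>n. (cmod (arcsine_coeff c n))\<^sup>2) has_sum 1) UNIV"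
proof -
  let ?a = "arcsine_coeff c"
  define g where "g = (\<lambda>(n, m). ?a n * cnj (?a m))"
  define \<phi> :: "int \<times> int \<Rightarrow> int" where "\<phi> = (\<lambda>(n, m). n - m)"
  have na: "(\<lambda>n. cmod (?a n)) summable_on UNIV"
    by (rule summable_on_comparison_test[OF arcsine_coeff_summable[of c]])
       (auto intro: mult_left_le_one_le simp: mult_le_cancel_right1)
  have sa: "(?a has_sum infsum ?a UNIV) UNIV" "((\<lambda>n. cnj (?a n)) has_sum infsum (\<lambda>n. cnj (?a n)) UNIV) UNIV"
    using Infinite_Sum.abs_summable_summable[OF na] by simp_all
  have ng: "(\<lambda>p. norm (g p)) summable_on UNIV"
    using has_sum_mult(2)[OF sa(1) na sa(2)] na by (simp add: g_def case_prod_unfold)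
  have "((\<lambda>n. infsum g {p. \<phi> p = n} * exp (\<i> * of_int n * of_real t)) has_sum 1) UNIV" for t
  proof (rule fourier_regroup[OF _ ng])
    let ?f = "\<lambda>n. ?a n * exp (\<i> * of_int n * of_real t)"
    let ?S = "exp (\<i> * of_real (sqrt 2 * sin t / c))"
    have "((\<lambda>(n, m). ?f n * cnj (?f m)) has_sum ?S * cnj ?S) UNIV"
      by (intro has_sum_mult arcsine_coeff_expansion has_sum_cnj_iff[THEN iffD2])
         (use na in \<open>simp_all add: norm_mult\<close>)
    moreover have "?S * cnj ?S = 1"
      by (simp only: exp_cnj exp_add[symmetric]) simp
    moreover have "?f n * cnj (?f m) = g (n, m) * exp (\<i> * of_int (\<phi> (n, m)) * of_real t)" for n m
    proof -
      have "exp (\<i> * of_int (\<phi> (n, m)) * of_real t) =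
          exp (\<i> * of_int n * of_real t + cnj (\<i> * of_int m * of_real t))"
        by (simp add: \<phi>_def algebra_simps)
      then show ?thesis
        by (simp only: exp_add exp_cnj g_def prod.case complex_cnj_mult[of "?a m"] mult_ac)
    qed
    ultimately show "((\<lambda>p. g p * exp (\<i> * of_int (\<phi> p) * of_real t)) has_sum 1) UNIV"
      by (simp add: case_prod_unfold)
  qed
  moreover have "((\<lambda>n. (if n = 0 then 1 else 0) * exp (\<i> * of_int n * of_real t)) has_sum 1) UNIV" for t
    using has_sum_finite_neutralI[of "{0}" UNIV "\<lambda>n. (if n = 0 then 1 else 0) * exp (\<i> * of_int n * of_real t)" 1]
    by simp
  ultimately have "(\<lambda>n. infsum g {p. \<phi> p = n}) = (\<lambda>n. if n = 0 then 1 else 0)"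
    by (rule fourier_coeff_unique)
  then have "infsum g {p. \<phi> p = 0} = 1"
    by (simp add: fun_eq_iff)
  moreover have "g summable_on {p. \<phi> p = 0}"
    by (rule Infinite_Sum.abs_summable_summable) (rule summable_on_subset_banach[OF ng], simp)
  ultimately have "(g has_sum 1) {p. \<phi> p = 0}"
    by (metis has_sum_infsum)
  moreover have "bij_betw (\<lambda>n. (n, n)) UNIV {p. \<phi> p = 0}"
    by (rule bij_betwI[where g = fst]) (auto simp: \<phi>_def)
  ultimately have "((\<lambda>n. g (n, n)) has_sum 1) UNIV"
    using has_sum_reindex_bij_betw[of "\<lambda>n. (n, n)" UNIV "{p. \<phi> p = 0}" g 1] by simp
  then have "((\<lambda>n. complex_of_real ((cmod (?a n))\<^sup>2)) has_sum complex_of_real 1) UNIV"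
    by (simp add: g_def complex_norm_square flip: of_real_power)
  then show ?thesis
    by (simp only: has_sum_of_real_iff)
qed

lemma prob_space_discrete_arcsine: "prob_space (discrete_arcsine c)"
proof -
  let ?w = "\<lambda>n. (cmod (arcsine_coeff c n))\<^sup>2"
  have s: "?w summable_on UNIV" "infsum ?w UNIV = 1"
    using arcsine_coeff_parseval[of c] by (auto simp: summable_on_def infsumI)
  then have i: "integrable (count_space UNIV) ?w"
    using abs_summable_equivalent[of ?w UNIV]
    by (simp add: Infinite_Set_Sum.abs_summable_on_def)
  have "(\<integral>\<^sup>+n. ennreal (?w n) \<partial>count_space UNIV) = ennreal (\<integral>n. ?w n \<partial>count_space UNIV)"
    by (rule nn_integral_eq_integral[OF i]) simp
  also have "(\<integral>n. ?w n \<partial>count_space UNIV) = infsum ?w UNIV"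
    using infsetsum_infsum[of ?w UNIV] i
    by (simp add: infsetsum_def Infinite_Set_Sum.abs_summable_on_def)
  finally have "emeasure (discrete_arcsine c) (space (discrete_arcsine c)) = 1"
    using s(2) by (simp add: discrete_arcsine_def emeasure_distr emeasure_density)
  then show ?thesis by (rule prob_spaceI)
qed

lemma integrable_discrete_arcsine_power: "integrable (discrete_arcsine c) (\<lambda>x. x ^ m)"
proof -
  let ?w = "\<lambda>n. (cmod (arcsine_coeff c n))\<^sup>2"
  let ?e = "\<lambda>n. exp \<bar>real_of_int n\<bar> * cmod (arcsine_coeff c n)"
  define K where "K = infsum ?e UNIV"
  have K: "cmod (arcsine_coeff c n) \<le> K" for n
  proof -
    have "cmod (arcsine_coeff c n) \<le> ?e n"
      by (simp add: mult_le_cancel_right1)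
    also have "?e n = infsum ?e {n}" by simp
    also have "\<dots> \<le> K"
      unfolding K_def
      by (rule infsum_mono_neutral) (auto intro: arcsine_coeff_summable)
    finally show ?thesis .
  qed
  have pow: "x ^ m \<le> fact m * exp x" if "x \<ge> 0" for x :: real
  proof -
    have "x ^ m / fact m \<le> exp x"
      using has_sum_mono_neutral[OF has_sum_finite[of "{m}" "\<lambda>n. x ^ n / fact n"] exp_has_sum(1)[of x]] that
      by auto
    then show ?thesis by (simp add: field_simps)
  qed
  have "(\<lambda>n. norm (?w n * (c * of_int n) ^ m)) summable_on UNIV"
  proof (rule summable_on_comparison_test)
    show "(\<lambda>n. (\<bar>c\<bar> ^ m * fact m * K) * ?e n) summable_on UNIV"
      by (intro summable_on_cmult_right arcsine_coeff_summable)
    fix n :: int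
    have "norm (?w n * (c * of_int n) ^ m) =
        \<bar>c\<bar> ^ m * (\<bar>real_of_int n\<bar> ^ m * (cmod (arcsine_coeff c n) * cmod (arcsine_coeff c n)))"
      by (simp add: abs_mult power_abs power_mult_distrib power2_eq_square mult_ac)
    also have "\<dots> \<le> \<bar>c\<bar> ^ m * ((fact m * exp \<bar>real_of_int n\<bar>) * (K * cmod (arcsine_coeff c n)))"
      by (intro mult_left_mono mult_mono pow K mult_right_mono) auto
    finally show "norm (?w n * (c * of_int n) ^ m) \<le> (\<bar>c\<bar> ^ m * fact m * K) * ?e n"
      by (simp add: mult_ac)
  qed auto
  then have "integrable (count_space UNIV) (\<lambda>n. ?w n * (c * of_int n) ^ m)"
    using abs_summable_equivalent[of "\<lambda>n. ?w n * (c * of_int n) ^ m" UNIV]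
    by (simp add: Infinite_Set_Sum.abs_summable_on_def)
  then show ?thesis
    unfolding discrete_arcsine_def
    by (subst integrable_distr_eq) (auto simp: integrable_density)
qed

end

theory Submission
  imports Defs
begin

text \<open>Centred at \<open>\<Phi>\<^sub>k\<close>, the matrix of \<open>(X - \<alpha>\<^sub>k) / sqrt (\<omega>\<^sub>k\<^sub>+\<^sub>1\<^sub>/\<^sub>2 + \<omega>\<^sub>k\<^sub>-\<^sub>1\<^sub>/\<^sub>2)\<close> converges entrywise to the doubly infinite Jacobi
  matrix \<open>T\<close> over \<open>\<int>\<close> with diagonal entries \<open>c j\<close> and off-diagonal entries \<open>1 / sqrt 2\<close>. Differentiating the
  Fourier expansion gives \<open>c n a\<^sub>n = (a\<^sub>n\<^sub>-\<^sub>1 + a\<^sub>n\<^sub>+\<^sub>1) / sqrt 2\<close>, so the sequences \<open>(a\<^sub>n\<^sub>-\<^sub>j)\<^sub>j\<close> are eigenvectors of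
  \<open>T\<close> with eigenvalues \<open>c n\<close>; they are orthonormal, whence the \<open>(j, 0)\<close> entry of \<open>T\<^sup>m\<close> is
  \<open>\<Sum>n. (c n)\<^sup>m a\<^sub>n\<^sub>-\<^sub>j cnj a\<^sub>n\<close>, and \<open>j = 0\<close> is the moment of the discrete arcsine distribution.\<close>

section \<open>Moments of the discrete arcsine distribution\<close>

text \<open>A single term of the exponential series is below its sum. Hence the exponentially
  weighted summability of the coefficients absorbs every polynomial weight in
  \<open>n\<close>.\<close>

lemma pow_abs_le_fact_exp: "\<bar>x\<bar> ^ m \<le> fact m * exp \<bar>x\<bar>" for x :: real
proof -
  have "\<bar>x\<bar> ^ m / fact m \<le> exp \<bar>x\<bar>"
    using has_sum_mono_neutral[OF has_sum_finite[of "{m}" "\<lambda>n. \<bar>x\<bar> ^ n / fact n"] exp_has_sum(1)[of "\<bar>x\<bar>"]]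
    by auto
  then show ?thesis by (simp add: field_simps)
qed

lemma arcsine_coeff_power_summable:
  "(\<lambda>n. norm (of_int n ^ m * arcsine_coeff c n)) summable_on UNIV"
proof (rule summable_on_comparison_test)
  show "(\<lambda>n. fact m * (exp \<bar>real_of_int n\<bar> * cmod (arcsine_coeff c n))) summable_on UNIV"
    by (intro summable_on_cmult_right arcsine_coeff_summable)
  show "norm (of_int n ^ m * arcsine_coeff c n)
      \<le> fact m * (exp \<bar>real_of_int n\<bar> * cmod (arcsine_coeff c n))" for n
    using mult_right_mono[OF pow_abs_le_fact_exp[of "real_of_int n" m], of "cmod (arcsine_coeff c n)"]
    by (simp add: norm_mult norm_power mult_ac)
qed auto

lemma arcsine_coeff_bounded: "\<exists>M. \<forall>n. cmod (arcsine_coeff c n) \<le> M"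
proof (intro exI allI)
  let ?f = "\<lambda>n. norm (of_int n ^ 0 * arcsine_coeff c n)"
  fix n
  have "cmod (arcsine_coeff c n) = infsum ?f {n}" by simp
  also have "\<dots> \<le> infsum ?f UNIV"
    by (rule infsum_mono_neutral) (auto intro: arcsine_coeff_power_summable simp del: power_0)
  finally show "cmod (arcsine_coeff c n) \<le> infsum ?f UNIV" .
qed

lemma arcsine_coeff_product_summable:
  "(\<lambda>n. norm (of_int n ^ m * arcsine_coeff c (n - j) * cnj (arcsine_coeff c n))) summable_on UNIV"
proof -
  obtain M where M: "\<And>n. cmod (arcsine_coeff c n) \<le> M"
    using arcsine_coeff_bounded by blast
  show ?thesis
  proof (rule summable_on_comparison_test)
    show "(\<lambda>n. M * norm (of_int n ^ m * arcsine_coeff c n)) summable_on UNIV"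
      by (intro summable_on_cmult_right arcsine_coeff_power_summable)
    show "norm (of_int n ^ m * arcsine_coeff c (n - j) * cnj (arcsine_coeff c n))
        \<le> M * norm (of_int n ^ m * arcsine_coeff c n)" for n
      using mult_right_mono[OF M[of "n - j"], of "norm (of_int n ^ m * arcsine_coeff c n)"]
      by (simp add: norm_mult mult_ac)
  qed auto
qed

lemma has_sum_int_shift:
  fixes f :: "int \<Rightarrow> 'a :: {topological_space, comm_monoid_add}"
  shows "((\<lambda>n. f (n + j)) has_sum S) UNIV \<longleftrightarrow> (f has_sum S) UNIV"
  by (rule has_sum_reindex_bij_betw) (rule bij_betwI[where g = "\<lambda>n. n - j"], auto)

section \<open>Three-term recurrence of the Fourier coefficients\<close>

text \<open>This is the Bessel recurrence, as \<open>arcsine_coeff c n\<close> is the Bessel value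
  \<open>J_n(sqrt 2 / c)\<close>. The termwise derivative of the expansion is compared with the
  chain rule, where multiplication by \<open>cos t\<close> amounts to index shifts.\<close>

lemma arcsine_coeff_recurrence:
  assumes "c \<noteq> 0"
  shows "of_real c * of_int n * arcsine_coeff c n =
    (arcsine_coeff c (n - 1) + arcsine_coeff c (n + 1)) / of_real (sqrt 2)"
proof -
  let ?a = "arcsine_coeff c"
  define F where "F t = exp (\<i> * complex_of_real (sqrt 2 * sin t / c))" for t
  define G where "G t = infsum (\<lambda>n. \<i> * of_int n * ?a n * exp (\<i> * of_int n * of_real t)) UNIV" for t
  define K where "K = infsum (\<lambda>n. norm (of_int n ^ 2 * ?a n)) UNIV"
  have F: "((\<lambda>n. ?a n * exp (\<i> * of_int n * of_real t)) has_sum F t) UNIV" for t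
    unfolding F_def by (rule arcsine_coeff_expansion)
  have G: "((\<lambda>n. \<i> * of_int n * ?a n * exp (\<i> * of_int n * of_real t)) has_sum G t) UNIV" for t
    unfolding G_def
    by (rule has_sum_infsum, rule Infinite_Sum.abs_summable_summable)
       (use arcsine_coeff_power_summable[of 1 c] in \<open>simp add: norm_mult\<close>)
  have K: "((\<lambda>n. norm (of_int n ^ 2 * ?a n)) has_sum K) UNIV"
    unfolding K_def by (intro has_sum_infsum arcsine_coeff_power_summable)
  \<comment> \<open>Termwise differentiation made quantitative: with \<open>y = n * h\<close>, the
    Taylor estimate \<open>|exp (i y) - 1 - i y| <= y^2 / 2\<close> controls each term, and
    \<open>K\<close> sums the resulting factors \<open>n^2\<close>.\<close>
  have bound: "norm (F (t + h) - F t - of_real h * G t) \<le> h\<^sup>2 / 2 * K" for t h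
  proof -
    define R where "R n = ?a n * exp (\<i> * of_int n * of_real t) *
        (exp (\<i> * of_real (n * h)) - 1 - \<i> * of_real (n * h))" for n
    have R: "(R has_sum (F (t + h) - F t - of_real h * G t)) UNIV"
    proof -
      have "?a n * exp (\<i> * of_int n * of_real (t + h)) - ?a n * exp (\<i> * of_int n * of_real t)
          - of_real h * (\<i> * of_int n * ?a n * exp (\<i> * of_int n * of_real t)) = R n" for n
      proof -
        have "\<i> * of_int n * of_real (t + h) = \<i> * of_int n * of_real t + \<i> * of_real (n * h)"
          by (simp add: algebra_simps)
        then show ?thesis
          by (simp only: R_def exp_add) (simp add: algebra_simps)
      qed
      then show ?thesis
        using has_sum_add[OF has_sum_add[OF F[of "t + h"] has_sum_uminusI[OF F[of t]]]
            has_sum_uminusI[OF has_sum_cmult_right[OF G[of t], of "of_real h"]]]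
        by simp
    qed
    show ?thesis
    proof (rule norm_infsum_le[OF R has_sum_cmult_right[OF K]])
      fix n :: int
      have "norm (exp (\<i> * of_real (n * h)) - 1 - \<i> * of_real (n * h)) \<le> (n * h)\<^sup>2 / 2"
        using iexp_approx1[of "n * h" 1] by (simp add: algebra_simps power2_eq_square)
      from mult_left_mono[OF this norm_ge_zero[of "?a n"]]
      show "norm (R n) \<le> h\<^sup>2 / 2 * norm (of_int n ^ 2 * ?a n)"
        by (simp add: R_def norm_mult norm_power power_mult_distrib mult_ac)
    qed
  qed
  \<comment> \<open>\<open>F\<close> has the derivative \<open>G t\<close> by the bound above and
    the right-hand side by the chain rule; derivatives are unique.\<close>
  have GF: "G t = \<i> * of_real (sqrt 2 * cos t / c) * F t" for t
  proof -
    have 1: "(F has_vector_derivative G t) (at t)"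
      unfolding has_vector_derivative_def has_derivative_at
    proof
      show "(\<lambda>h. norm (F (t + h) - F t - h *\<^sub>R G t) / norm h) \<midarrow>0\<rightarrow> 0"
      proof (rule Lim_null_comparison)
        show "(\<lambda>h. \<bar>h\<bar> / 2 * K) \<midarrow>0\<rightarrow> 0"
          by (auto intro!: tendsto_eq_intros)
        show "\<forall>\<^sub>F h in at 0. norm (norm (F (t + h) - F t - h *\<^sub>R G t) / norm h) \<le> \<bar>h\<bar> / 2 * K"
          using eventually_neq_at_within[of 0]
        proof eventually_elim
          case (elim h)
          have "\<bar>h\<bar> / 2 * K * \<bar>h\<bar> = h\<^sup>2 / 2 * K"
            by (simp add: power2_eq_square)
          with bound[of t h] have "norm (F (t + h) - F t - h *\<^sub>R G t) \<le> \<bar>h\<bar> / 2 * K * \<bar>h\<bar>"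
            by (simp only: scaleR_conv_of_real)
          then have "norm (F (t + h) - F t - h *\<^sub>R G t) / \<bar>h\<bar> \<le> \<bar>h\<bar> / 2 * K"
            using elim by (subst pos_divide_le_eq) auto
          then show ?case by simp
        qed
      qed
    qed (rule bounded_linear_scaleR_left)
    have 2: "(F has_vector_derivative \<i> * of_real (sqrt 2 * cos t / c) * F t) (at t)"
    proof -
      have "((\<lambda>t. sqrt 2 * sin t / c) has_real_derivative sqrt 2 * cos t / c) (at t)"
        using assms by (auto intro!: derivative_eq_intros)
      then have "((\<lambda>t. complex_of_real (sqrt 2 * sin t / c)) has_vector_derivative
          of_real (sqrt 2 * cos t / c)) (at t)"
        by (intro has_vector_derivative_of_real) (simp only: has_real_derivative_iff_has_vector_derivative)
      moreover have "((\<lambda>z. exp (\<i> * z)) has_field_derivative \<i> * exp (\<i> * z)) (at z)" for z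
        by (auto intro!: derivative_eq_intros)
      ultimately have "((\<lambda>z. exp (\<i> * z)) \<circ> (\<lambda>t. complex_of_real (sqrt 2 * sin t / c)) has_vector_derivative
          of_real (sqrt 2 * cos t / c) * (\<i> * exp (\<i> * of_real (sqrt 2 * sin t / c)))) (at t)"
        by (rule field_vector_diff_chain_at)
      then show ?thesis
        by (simp only: F_def[abs_def] o_def mult.left_commute mult.assoc)
    qed
    from 1 2 show ?thesis by (rule vector_derivative_unique_at)
  qed
  \<comment> \<open>Multiplying the derivative series by \<open>- i c\<close> turns
    \<open>i n\<close> into \<open>c n\<close> and cancels \<open>i / c\<close> on the other
    side.\<close>
  have "((\<lambda>n. of_real c * of_int n * ?a n * exp (\<i> * of_int n * of_real t)) has_sum
      of_real (sqrt 2 * cos t) * F t) UNIV" for t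
    using has_sum_cmult_right[OF G[of t], of "- \<i> * of_real c"] assms by (simp add: GF mult_ac)
  \<comment> \<open>Here \<open>sqrt 2 * cos t\<close> is split as
    \<open>(exp (i t) + exp (- i t)) / sqrt 2\<close>; each exponential shifts the series by one
    index.\<close>
  moreover have "((\<lambda>n. (?a (n - 1) + ?a (n + 1)) / of_real (sqrt 2) * exp (\<i> * of_int n * of_real t)) has_sum
      of_real (sqrt 2 * cos t) * F t) UNIV" for t
  proof -
    let ?e = "exp (\<i> * of_real t)" and ?e' = "exp (- (\<i> * of_real t))"
    have e: "exp (\<i> * of_int (n + 1) * of_real t) = exp (\<i> * of_int n * of_real t) * ?e"
      and e': "exp (\<i> * of_int (n - 1) * of_real t) = exp (\<i> * of_int n * of_real t) * ?e'" for n
      by (simp_all add: algebra_simps flip: exp_add)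
    have "((\<lambda>n. ?a (n - 1) * exp (\<i> * of_int (n - 1) * of_real t)) has_sum F t) UNIV"
      using has_sum_int_shift[of "\<lambda>n. ?a n * exp (\<i> * of_int n * of_real t)" "-1"] F by simp
    note A = has_sum_cmult_right[OF this, of "?e / of_real (sqrt 2)"]
    have "((\<lambda>n. ?a (n + 1) * exp (\<i> * of_int (n + 1) * of_real t)) has_sum F t) UNIV"
      using has_sum_int_shift[of "\<lambda>n. ?a n * exp (\<i> * of_int n * of_real t)" 1] F by simp
    note B = has_sum_cmult_right[OF this, of "?e' / of_real (sqrt 2)"]
    have "?e / of_real (sqrt 2) * (?a (n - 1) * exp (\<i> * of_int (n - 1) * of_real t)) +
        ?e' / of_real (sqrt 2) * (?a (n + 1) * exp (\<i> * of_int (n + 1) * of_real t)) =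
        (?a (n - 1) + ?a (n + 1)) / of_real (sqrt 2) * exp (\<i> * of_int n * of_real t)" for n
      unfolding e e' by (simp add: field_simps flip: exp_add)
    moreover have "?e / of_real (sqrt 2) * F t + ?e' / of_real (sqrt 2) * F t = of_real (sqrt 2 * cos t) * F t"
    proof -
      have "?e + ?e' = of_real (2 * cos t)"
        using cos_exp_eq[of "of_real t"] by (simp add: mult.commute flip: cos_of_real)
      moreover have "2 * cos t / sqrt 2 = sqrt 2 * cos t"
        by (simp add: field_simps)
      ultimately show ?thesis
        by (metis add_divide_distrib distrib_right of_real_divide)
    qed
    ultimately show ?thesis
      using has_sum_add[OF A B] by simp
  qed
  ultimately have "(\<lambda>n. of_real c * of_int n * ?a n) = (\<lambda>n. (?a (n - 1) + ?a (n + 1)) / of_real (sqrt 2))"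
    by (rule fourier_coeff_unique)
  then show ?thesis by (rule fun_cong)
qed

section \<open>Entries of the powers of the limit matrix\<close>

text \<open>Spectral form of the \<open>(j, 0)\<close> entry of \<open>T^m\<close>. All offsets
  \<open>j\<close> are kept because the recursion in \<open>m\<close> couples neighbouring
  ones.\<close>

definition arcsine_moment :: "real \<Rightarrow> nat \<Rightarrow> int \<Rightarrow> complex" where
  "arcsine_moment c m j =
    infsum (\<lambda>n. of_real ((c * of_int n) ^ m) * arcsine_coeff c (n - j) * cnj (arcsine_coeff c n)) UNIV"

lemma has_sum_arcsine_moment:
  "((\<lambda>n. of_real ((c * of_int n) ^ m) * arcsine_coeff c (n - j) * cnj (arcsine_coeff c n))
    has_sum arcsine_moment c m j) UNIV"
proof -
  have "(\<lambda>n. of_real c ^ m * (of_int n ^ m * arcsine_coeff c (n - j) * cnj (arcsine_coeff c n))) summable_on UNIV"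
    by (rule summable_on_cmult_right, rule Infinite_Sum.abs_summable_summable, rule arcsine_coeff_product_summable)
  then show ?thesis
    unfolding arcsine_moment_def by (intro has_sum_infsum) (simp add: power_mult_distrib mult_ac)
qed

text \<open>One factor \<open>c n\<close> is split as \<open>c j + c (n - j)\<close>, and the second
  part is absorbed by the recurrence at index \<open>n - j\<close>.\<close>

lemma arcsine_moment_Suc:
  assumes "c \<noteq> 0"
  shows "arcsine_moment c (Suc m) j = of_real (c * of_int j) * arcsine_moment c m j +
    (arcsine_moment c m (j + 1) + arcsine_moment c m (j - 1)) / of_real (sqrt 2)"
proof (rule has_sum_unique[OF has_sum_arcsine_moment])
  let ?a = "arcsine_coeff c"
  let ?f = "\<lambda>j n. of_real ((c * of_int n) ^ m) * ?a (n - j) * cnj (?a n)"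
  have "of_real (c * of_int j) * ?f j n + 1 / of_real (sqrt 2) * (?f (j + 1) n + ?f (j - 1) n) =
      of_real ((c * of_int n) ^ Suc m) * ?a (n - j) * cnj (?a n)" for n
  proof -
    have "of_real (c * of_int n) * ?a (n - j) = of_real (c * of_int j) * ?a (n - j) +
        (?a (n - (j + 1)) + ?a (n - (j - 1))) / of_real (sqrt 2)"
      using arcsine_coeff_recurrence[OF assms, of "n - j"] by (simp add: algebra_simps)
    from arg_cong[OF this, of "\<lambda>x. of_real ((c * of_int n) ^ m) * x * cnj (?a n)"]
    show ?thesis by (simp add: algebra_simps add_divide_distrib)
  qed
  then show "((\<lambda>n. of_real ((c * of_int n) ^ Suc m) * ?a (n - j) * cnj (?a n)) has_sum
      (of_real (c * of_int j) * arcsine_moment c m j +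
        (arcsine_moment c m (j + 1) + arcsine_moment c m (j - 1)) / of_real (sqrt 2))) UNIV"
    using has_sum_add[OF has_sum_cmult_right[OF has_sum_arcsine_moment[of c m j], of "of_real (c * of_int j)"]
      has_sum_cmult_right[OF has_sum_add[OF has_sum_arcsine_moment[of c m "j + 1"] has_sum_arcsine_moment[of c m "j - 1"]],
        of "1 / of_real (sqrt 2)"]]
    by simp
qed

text \<open>Orthogonality holds because the sequences \<open>(a\<^sub>n\<^sub>-\<^sub>j)\<^sub>n\<close> and \<open>(a\<^sub>n)\<^sub>n\<close> belong to the eigenvalues \<open>c j\<close> and \<open>0\<close> of
  one symmetric operator: applying the recurrence to either factor of \<open>c n a\<^sub>n\<^sub>-\<^sub>j cnj a\<^sub>n\<close> yields sums
  that differ by \<open>c j\<close> times the inner product.\<close>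

lemma arcsine_moment_0:
  assumes "c \<noteq> 0"
  shows "arcsine_moment c 0 j = (if j = 0 then 1 else 0)"
proof (cases "j = 0")
  case True
  have "((\<lambda>n. of_real ((cmod (arcsine_coeff c n))\<^sup>2)) has_sum complex_of_real 1) UNIV"
    using arcsine_coeff_parseval by (simp only: has_sum_of_real_iff)
  then show ?thesis
    using has_sum_unique[OF has_sum_arcsine_moment[of c 0 0]] True
    by (simp add: complex_norm_square flip: of_real_power)
next
  case False
  let ?a = "arcsine_coeff c"
  let ?f = "\<lambda>j n. ?a (n - j) * cnj (?a n)"
  have R: "(?f j has_sum arcsine_moment c 0 j) UNIV" for j
    using has_sum_arcsine_moment[of c 0 j] by simp
  have "arcsine_moment c (Suc 0) j =
      (arcsine_moment c 0 (j + 1) + arcsine_moment c 0 (j - 1)) / of_real (sqrt 2)"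
  proof (rule has_sum_unique[OF has_sum_arcsine_moment])
    \<comment> \<open>The index shifts keep the first factor at \<open>n - j\<close> and move the
      neighbours onto the conjugated factor, where the recurrence at \<open>n\<close>
      applies.\<close>
    have "1 / of_real (sqrt 2) * (?f (j + 1) (n + 1) + ?f (j - 1) (n + - 1)) =
        of_real ((c * of_int n) ^ Suc 0) * ?a (n - j) * cnj (?a n)" for n
      using arg_cong[OF arcsine_coeff_recurrence[OF assms, of n], of "\<lambda>x. ?a (n - j) * cnj x"]
      by (simp add: algebra_simps add_divide_distrib)
    then show "((\<lambda>n. of_real ((c * of_int n) ^ Suc 0) * ?a (n - j) * cnj (?a n)) has_sum
        (arcsine_moment c 0 (j + 1) + arcsine_moment c 0 (j - 1)) / of_real (sqrt 2)) UNIV"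
      using has_sum_cmult_right[OF has_sum_add[OF
          R[of "j + 1", folded has_sum_int_shift[of "?f (j + 1)" 1]]
          R[of "j - 1", folded has_sum_int_shift[of "?f (j - 1)" "- 1"]]],
          of "1 / of_real (sqrt 2)"]
      by simp
  qed
  with arcsine_moment_Suc[OF assms, of 0 j] show ?thesis
    using False assms by simp
qed

lemma integral_discrete_arcsine_power:
  "complex_of_real (\<integral>x. x ^ m \<partial>discrete_arcsine c) = arcsine_moment c m 0"
proof -
  let ?w = "\<lambda>n. (cmod (arcsine_coeff c n))\<^sup>2"
  let ?f = "\<lambda>n. ?w n * (c * of_int n) ^ m"
  have i: "integrable (count_space UNIV) ?f"
    using integrable_discrete_arcsine_power[of c m] unfolding discrete_arcsine_def
    by (subst (asm) integrable_distr_eq) (auto simp: integrable_density)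
  have "(\<integral>x. x ^ m \<partial>discrete_arcsine c) = (\<integral>n. ?f n \<partial>count_space UNIV)"
    unfolding discrete_arcsine_def by (simp add: integral_distr integral_density)
  also have "\<dots> = infsum ?f UNIV"
    using infsetsum_infsum[of ?f UNIV] i
    by (simp add: infsetsum_def Infinite_Set_Sum.abs_summable_on_def)
  finally have eq: "(\<integral>x. x ^ m \<partial>discrete_arcsine c) = infsum ?f UNIV" .
  have "?f summable_on UNIV"
    using i abs_summable_equivalent[of ?f UNIV] Infinite_Sum.abs_summable_summable[of ?f UNIV]
    by (simp add: Infinite_Set_Sum.abs_summable_on_def)
  then have "((\<lambda>n. of_real (?f n)) has_sum complex_of_real (infsum ?f UNIV)) UNIV"
    by (simp only: has_sum_of_real_iff has_sum_infsum)
  moreover have "of_real (?f n) =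
      of_real ((c * of_int n) ^ m) * arcsine_coeff c (n - 0) * cnj (arcsine_coeff c n)" for n
    by (simp add: complex_norm_square mult_ac flip: of_real_power)
  ultimately show ?thesis
    using has_sum_unique[OF has_sum_arcsine_moment[of c m 0]] by (simp only: eq)
qed

section \<open>Entrywise convergence of the normalized operator\<close>

lemma lookup_linear_extension:
  "Poly_Mapping.lookup (linear_extension b v) l =
    (\<Sum>n\<in>Poly_Mapping.keys v. Poly_Mapping.lookup v n * Poly_Mapping.lookup (b n) l)"
  by (simp add: linear_extension_def lookup_sum)

text \<open>Made for \<open>A\<close>, \<open>B\<close> and \<open>C\<close>: at most one basis
  vector contributes to a given coordinate of the image.\<close>

lemma lookup_linear_extension_single:
  assumes "\<And>n. n \<noteq> p \<Longrightarrow> Poly_Mapping.lookup (b n) l = 0"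
  shows "Poly_Mapping.lookup (linear_extension b v) l =
    Poly_Mapping.lookup v p * Poly_Mapping.lookup (b p) l"
proof -
  have "Poly_Mapping.lookup (linear_extension b v) l =
      (\<Sum>n\<in>Poly_Mapping.keys v. if n = p then Poly_Mapping.lookup v p * Poly_Mapping.lookup (b p) l else 0)"
    unfolding lookup_linear_extension by (rule sum.cong) (use assms in auto)
  also have "\<dots> = Poly_Mapping.lookup v p * Poly_Mapping.lookup (b p) l"
    by (auto simp: in_keys_iff)
  finally show ?thesis .
qed

lemma lookup_fock_A:
  "Poly_Mapping.lookup (fock_A \<omega> v) l = of_real (sqrt (\<omega> l)) * Poly_Mapping.lookup v (Suc l)"
  unfolding fock_A_def
  by (subst lookup_linear_extension_single[where p = "Suc l"]) (auto simp: lookup_single when_def)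

lemma lookup_fock_B:
  "Poly_Mapping.lookup (fock_B \<alpha> v) l = of_real (\<alpha> l) * Poly_Mapping.lookup v l"
  unfolding fock_B_def
  by (subst lookup_linear_extension_single[where p = l]) (auto simp: lookup_single when_def)

lemma lookup_fock_C_Suc:
  "Poly_Mapping.lookup (fock_C \<omega> v) (Suc l) = of_real (sqrt (\<omega> l)) * Poly_Mapping.lookup v l"
  unfolding fock_C_def
  by (subst lookup_linear_extension_single[where p = l]) (auto simp: lookup_single when_def)

text \<open>A row of the Jacobi matrix away from the boundary; in row 0 the contribution of
  \<open>C\<close> is absent.\<close>

lemma lookup_normalized_X_Suc:
  fixes \<omega> \<alpha> :: "nat \<Rightarrow> real"
  defines "s \<equiv> \<lambda>k. sqrt (\<omega> k + \<omega> (k - 1))"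
  shows "Poly_Mapping.lookup (normalized_X \<omega> \<alpha> k v) (Suc l) =
    of_real ((\<alpha> (Suc l) - \<alpha> k) / s k) * Poly_Mapping.lookup v (Suc l) +
    of_real (sqrt (\<omega> (Suc l)) / s k) * Poly_Mapping.lookup v (Suc (Suc l)) +
    of_real (sqrt (\<omega> l) / s k) * Poly_Mapping.lookup v l"
  by (simp add: normalized_X_def fock_X_def lookup_add lookup_minus lookup_fock_A lookup_fock_B
      lookup_fock_C_Suc s_def algebra_simps add_divide_distrib diff_divide_distrib)

lemma fock_inner_Phi_right: "fock_inner v (Phi k) = Poly_Mapping.lookup v k"
  by (cases "k \<in> Poly_Mapping.keys v") (simp_all add: fock_inner_def in_keys_iff)

text \<open>At \<open>n = 0\<close> truncated subtraction would make the right-hand side vanish,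
  while the commutator gives \<open>\<omega> 0\<close> times \<open>Phi 0\<close>.\<close>

lemma fock_commutator_A_C_Phi:
  assumes "jacobi_sequence \<omega> \<alpha>" "n \<ge> 1"
  shows "commutator (fock_A \<omega>) (fock_C \<omega>) (Phi n) = fock_scale (of_real (\<omega> n - \<omega> (n - 1))) (Phi n)"
proof (rule poly_mapping_eqI)
  fix l
  obtain p where n: "n = Suc p" using assms(2) by (cases n) auto
  have sq: "complex_of_real (sqrt (\<omega> i)) * of_real (sqrt (\<omega> i)) = of_real (\<omega> i)" for i
    using assms(1) by (simp add: jacobi_sequence_def less_imp_le flip: of_real_mult)
  show "Poly_Mapping.lookup (commutator (fock_A \<omega>) (fock_C \<omega>) (Phi n)) l =
      Poly_Mapping.lookup (fock_scale (of_real (\<omega> n - \<omega> (n - 1))) (Phi n)) l"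
  proof (cases l)
    case 0
    have "Poly_Mapping.lookup (fock_C \<omega> v) 0 = 0" for v
      by (simp add: fock_C_def lookup_linear_extension lookup_single)
    with 0 show ?thesis
      by (simp add: commutator_def n lookup_minus lookup_fock_A lookup_fock_C_Suc lookup_single when_def)
  next
    case (Suc q)
    then show ?thesis
      by (auto simp: commutator_def n lookup_minus lookup_fock_A lookup_fock_C_Suc lookup_single when_def
          sq algebra_simps mult.assoc[symmetric])
  qed
qed

section \<open>Asymptotics of the Jacobi parameters around position \<open>k\<close>\<close>

text \<open>Coordinates are addressed by an integer offset \<open>j\<close> from \<open>k\<close>;
  for fixed \<open>j\<close>, truncation by \<open>nat\<close> affects only finitely many
  \<open>k\<close>.\<close>

lemma filterlim_nat_int_shift: "filterlim (\<lambda>k. nat (int k + j)) sequentially sequentially"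
  unfolding filterlim_at_top
proof
  fix Z
  show "\<forall>\<^sub>F k in sequentially. Z \<le> nat (int k + j)"
    by (rule eventually_sequentiallyI[of "Z + nat \<bar>j\<bar>"]) linarith
qed

lemma eventually_int_shift_pos: "\<forall>\<^sub>F k in sequentially. int k + j \<ge> 1"
  by (rule eventually_sequentiallyI[of "1 + nat \<bar>j\<bar>"]) linarith

text \<open>The hypotheses in scalar form: \<open>omega_lim\<close> is the condition on
  \<open>AC - CA\<close>, and \<open>alpha_lim\<close> is the limit defining
  \<open>c\<close>.\<close>

locale regular_jacobi =
  fixes \<omega> \<alpha> :: "nat \<Rightarrow> real" and c :: real
  assumes jacobi: "jacobi_sequence \<omega> \<alpha>"
    and omega_lim: "(\<lambda>n. (\<omega> n - \<omega> (n - 1)) / (\<omega> n + \<omega> (n - 1))) \<longlonglongrightarrow> 0"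
    and alpha_lim: "(\<lambda>n. (\<alpha> n - \<alpha> (n - 1)) / sqrt (\<omega> (n - 1) + \<omega> n)) \<longlonglongrightarrow> c"
begin

definition s :: "nat \<Rightarrow> real" where "s k = sqrt (\<omega> k + \<omega> (k - 1))"

lemma pos: "\<omega> n > 0" "s n > 0"
  using jacobi by (simp_all add: jacobi_sequence_def s_def add_pos_pos)

text \<open>With \<open>d\<close> the quotient in \<open>omega_lim\<close>, the ratio equals
  \<open>(1 + d) / (1 - d)\<close>.\<close>

lemma omega_ratio: "(\<lambda>n. \<omega> n / \<omega> (n - 1)) \<longlonglongrightarrow> 1"
proof -
  define d where "d n = (\<omega> n - \<omega> (n - 1)) / (\<omega> n + \<omega> (n - 1))" for n
  have "d \<longlonglongrightarrow> 0" using omega_lim by (simp only: d_def[abs_def])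
  then have "(\<lambda>n. (1 + d n) / (1 - d n)) \<longlonglongrightarrow> (1 + 0) / (1 - 0)"
    by (intro tendsto_intros) auto
  moreover have "(1 + d n) / (1 - d n) = \<omega> n / \<omega> (n - 1)" for n
  proof -
    have "\<omega> n + \<omega> (n - 1) > 0" using pos[of n] pos[of "n - 1"] by simp
    then have "1 + d n = 2 * \<omega> n / (\<omega> n + \<omega> (n - 1))" "1 - d n = 2 * \<omega> (n - 1) / (\<omega> n + \<omega> (n - 1))"
      by (simp_all add: d_def field_simps)
    then show ?thesis using \<open>\<omega> n + \<omega> (n - 1) > 0\<close> by simp
  qed
  ultimately show ?thesis by simp
qed

text \<open>Consecutive ratios telescope, upwards and downwards in \<open>j\<close>. The index
  identities in both steps survive truncation at 0, so they hold for every \<open>k\<close>.\<close>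

lemma omega_ratio_shift: "(\<lambda>k. \<omega> (nat (int k + j)) / \<omega> k) \<longlonglongrightarrow> 1"
proof (induction j rule: int_induct[where k = 0])
  case base
  show ?case using pos by (simp add: less_imp_neq[symmetric])
next
  case (step1 i)
  have "(\<lambda>k. \<omega> (nat (int k + (i + 1))) / \<omega> (nat (int k + (i + 1)) - 1) * (\<omega> (nat (int k + i)) / \<omega> k)) \<longlonglongrightarrow> 1 * 1"
    by (intro tendsto_mult filterlim_compose[OF omega_ratio filterlim_nat_int_shift] step1)
  moreover have "\<omega> (nat (int k + (i + 1))) / \<omega> (nat (int k + (i + 1)) - 1) * (\<omega> (nat (int k + i)) / \<omega> k) =
      \<omega> (nat (int k + (i + 1))) / \<omega> k" for k
  proof -
    have "nat (int k + (i + 1)) - 1 = nat (int k + i)" by linarith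
    then show ?thesis using pos(1)[of "nat (int k + i)"] by simp
  qed
  ultimately show ?case by simp
next
  case (step2 i)
  have "(\<lambda>k. \<omega> (nat (int k + i)) / \<omega> k / (\<omega> (nat (int k + i)) / \<omega> (nat (int k + i) - 1))) \<longlonglongrightarrow> 1 / 1"
    by (intro tendsto_divide filterlim_compose[OF omega_ratio filterlim_nat_int_shift] step2) simp
  moreover have "\<omega> (nat (int k + i)) / \<omega> k / (\<omega> (nat (int k + i)) / \<omega> (nat (int k + i) - 1)) =
      \<omega> (nat (int k + (i - 1))) / \<omega> k" for k
  proof -
    have "nat (int k + i) - 1 = nat (int k + (i - 1))" by linarith
    then show ?thesis using pos(1)[of "nat (int k + i)"] by simp
  qed
  ultimately show ?case by simp
qed

text \<open>The off-diagonal entries of \<open>T\<close>: after division by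
  \<open>\<omega> k\<close>, the square of the quotient tends to \<open>1 / (1 + 1)\<close>.\<close>

lemma omega_over_s: "(\<lambda>k. sqrt (\<omega> (nat (int k + j))) / s k) \<longlonglongrightarrow> 1 / sqrt 2"
proof -
  have "(\<lambda>k. sqrt ((\<omega> (nat (int k + j)) / \<omega> k) / (1 + \<omega> (nat (int k + - 1)) / \<omega> k))) \<longlonglongrightarrow> sqrt (1 / (1 + 1))"
    by (intro tendsto_intros omega_ratio_shift) simp
  moreover have "sqrt ((\<omega> (nat (int k + j)) / \<omega> k) / (1 + \<omega> (nat (int k + - 1)) / \<omega> k)) =
      sqrt (\<omega> (nat (int k + j))) / s k" for k
  proof -
    have "nat (int k + - 1) = k - 1" by linarith
    moreover have "\<omega> k + \<omega> (k - 1) > 0" using pos[of k] pos[of "k - 1"] by simp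
    moreover have "1 + \<omega> (k - 1) / \<omega> k = (\<omega> k + \<omega> (k - 1)) / \<omega> k"
      using pos[of k] by (simp add: field_simps)
    ultimately show ?thesis
      using pos[of k] by (simp add: s_def real_sqrt_divide)
  qed
  ultimately show ?thesis by (simp only:) (simp add: real_sqrt_divide)
qed

lemma s_ratio: "(\<lambda>k. s (nat (int k + j)) / s k) \<longlonglongrightarrow> 1"
proof -
  \<comment> \<open>The same square root is measured against \<open>s\<close> at \<open>k\<close>
    and at \<open>k + j\<close>, and cancels in the quotient. The \<open>+ 0\<close> is offset 0 at
    the shifted position.\<close>
  have "(\<lambda>k. (sqrt (\<omega> (nat (int k + j))) / s k) /
      (sqrt (\<omega> (nat (int (nat (int k + j)) + 0))) / s (nat (int k + j)))) \<longlonglongrightarrow> (1 / sqrt 2) / (1 / sqrt 2)"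
    by (intro tendsto_divide omega_over_s filterlim_compose[OF omega_over_s filterlim_nat_int_shift]) simp
  moreover have "(sqrt (\<omega> (nat (int k + j))) / s k) /
      (sqrt (\<omega> (nat (int (nat (int k + j)) + 0))) / s (nat (int k + j))) = s (nat (int k + j)) / s k" for k
    using pos(1)[of "nat (int k + j)"] by simp
  ultimately show ?thesis by simp
qed

lemma alpha_step: "(\<lambda>k. (\<alpha> (nat (int k + j)) - \<alpha> (nat (int k + j) - 1)) / s k) \<longlonglongrightarrow> c"
proof -
  have "(\<lambda>n. (\<alpha> n - \<alpha> (n - 1)) / s n) \<longlonglongrightarrow> c"
    using alpha_lim by (simp add: s_def add.commute)
  from tendsto_mult[OF filterlim_compose[OF this filterlim_nat_int_shift] s_ratio, of j j]
  show ?thesis using pos(2) by (simp add: less_imp_neq[symmetric])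
qed

text \<open>The diagonal entries of \<open>T\<close>: the difference telescopes into single steps,
  each contributing \<open>c\<close> once \<open>s_ratio\<close> has changed its normalization to
  \<open>s k\<close>.\<close>

lemma alpha_over_s: "(\<lambda>k. (\<alpha> (nat (int k + j)) - \<alpha> k) / s k) \<longlonglongrightarrow> c * of_int j"
proof (induction j rule: int_induct[where k = 0])
  case base
  show ?case by simp
next
  case (step1 i)
  have "nat (int k + (i + 1)) - 1 = nat (int k + i)" for k by linarith
  then show ?case
    using tendsto_add[OF alpha_step[of "i + 1"] step1(2)]
    by (simp add: diff_divide_distrib algebra_simps)
next
  case (step2 i)
  have "nat (int k + i) - 1 = nat (int k + (i - 1))" for k by linarith
  then show ?case
    using tendsto_diff[OF step2(2) alpha_step[of i]]
    by (simp add: diff_divide_distrib algebra_simps)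
qed

section \<open>Convergence of the powers and the limit theorem\<close>

text \<open>Each application of the operator mixes only three neighbouring coordinates, so entrywise
  limits pass through it, and in the limit they obey the recursion
  \<open>arcsine_moment_Suc\<close>.\<close>

lemma lookup_normalized_X_power_tendsto:
  assumes "c \<noteq> 0"
  shows "(\<lambda>k. Poly_Mapping.lookup ((normalized_X \<omega> \<alpha> k ^^ m) (Phi k)) (nat (int k + j)))
    \<longlonglongrightarrow> arcsine_moment c m j"
proof (induction m arbitrary: j)
  case 0
  have "\<forall>\<^sub>F k in sequentially. arcsine_moment c 0 j =
      Poly_Mapping.lookup ((normalized_X \<omega> \<alpha> k ^^ 0) (Phi k)) (nat (int k + j))"
    \<comment> \<open>Excludes truncation, which for \<open>k = 0\<close> and \<open>j < 0\<close>
      would wrongly identify position \<open>k + j\<close> with \<open>k\<close>.\<close>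
    using eventually_int_shift_pos[of j]
    by eventually_elim (auto simp: arcsine_moment_0[OF assms] lookup_single when_def)
  then show ?case by (rule tendsto_eventually[OF eventually_mono]) simp
next
  case (Suc m)
  define v where "v k = (normalized_X \<omega> \<alpha> k ^^ m) (Phi k)" for k
  have v: "(\<lambda>k. Poly_Mapping.lookup (v k) (nat (int k + j))) \<longlonglongrightarrow> arcsine_moment c m j" for j
    unfolding v_def by (rule Suc)
  have "(\<lambda>k. of_real ((\<alpha> (nat (int k + j)) - \<alpha> k) / s k) * Poly_Mapping.lookup (v k) (nat (int k + j)) +
      of_real (sqrt (\<omega> (nat (int k + j))) / s k) * Poly_Mapping.lookup (v k) (nat (int k + (j + 1))) +
      of_real (sqrt (\<omega> (nat (int k + (j - 1)))) / s k) * Poly_Mapping.lookup (v k) (nat (int k + (j - 1))))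
    \<longlonglongrightarrow> of_real (c * of_int j) * arcsine_moment c m j +
      of_real (1 / sqrt 2) * arcsine_moment c m (j + 1) + of_real (1 / sqrt 2) * arcsine_moment c m (j - 1)"
    by (intro tendsto_add tendsto_mult tendsto_of_real v omega_over_s alpha_over_s)
  also have "of_real (c * of_int j) * arcsine_moment c m j +
      of_real (1 / sqrt 2) * arcsine_moment c m (j + 1) + of_real (1 / sqrt 2) * arcsine_moment c m (j - 1) =
      arcsine_moment c (Suc m) j"
    by (simp add: arcsine_moment_Suc[OF assms] add_divide_distrib)
  finally show ?case
  proof (rule Lim_transform_eventually)
    show "\<forall>\<^sub>F k in sequentially.
        of_real ((\<alpha> (nat (int k + j)) - \<alpha> k) / s k) * Poly_Mapping.lookup (v k) (nat (int k + j)) +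
        of_real (sqrt (\<omega> (nat (int k + j))) / s k) * Poly_Mapping.lookup (v k) (nat (int k + (j + 1))) +
        of_real (sqrt (\<omega> (nat (int k + (j - 1)))) / s k) * Poly_Mapping.lookup (v k) (nat (int k + (j - 1))) =
        Poly_Mapping.lookup ((normalized_X \<omega> \<alpha> k ^^ Suc m) (Phi k)) (nat (int k + j))"
      using eventually_int_shift_pos[of j]
    proof eventually_elim
      case (elim k)
      \<comment> \<open>Since \<open>k + j >= 1\<close>, the middle coordinate is a successor and
        the interior row formula applies.\<close>
      define l where "l = nat (int k + (j - 1))"
      have l: "nat (int k + (j - 1)) = l" "nat (int k + j) = Suc l" "nat (int k + (j + 1)) = Suc (Suc l)"
        using elim unfolding l_def by linarith+
      show ?case
        unfolding l funpow.simps o_apply v_def[symmetric] lookup_normalized_X_Suc s_def ..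
    qed
  qed
qed

end

text \<open>For \<open>n >= 1\<close> the commutator maps \<open>Phi n\<close> to a scalar multiple
  of itself, so the Fock norm is the absolute value of that scalar.\<close>

lemma RAC2_imp_omega_lim:
  assumes "jacobi_sequence \<omega> \<alpha>" "RAC2 \<omega> \<alpha>"
  shows "(\<lambda>n. (\<omega> n - \<omega> (n - 1)) / (\<omega> n + \<omega> (n - 1))) \<longlonglongrightarrow> 0"
proof (rule tendsto_rabs_zero_cancel)
  have "(\<lambda>n. fock_norm (fock_scale (of_real (1 / (\<omega> n + \<omega> (n - 1))))
      (commutator (fock_A \<omega>) (fock_C \<omega>) (Phi n)) - 0)) \<longlonglongrightarrow> 0"
    using assms(2) by (simp add: RAC2_def fock_tendsto_def)
  then show "(\<lambda>n. \<bar>(\<omega> n - \<omega> (n - 1)) / (\<omega> n + \<omega> (n - 1))\<bar>) \<longlonglongrightarrow> 0"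
  proof (rule Lim_transform_eventually)
    show "\<forall>\<^sub>F n in sequentially. fock_norm (fock_scale (of_real (1 / (\<omega> n + \<omega> (n - 1))))
        (commutator (fock_A \<omega>) (fock_C \<omega>) (Phi n)) - 0) = \<bar>(\<omega> n - \<omega> (n - 1)) / (\<omega> n + \<omega> (n - 1))\<bar>"
      using eventually_ge_at_top[of 1]
    proof eventually_elim
      case (elim n)
      have "fock_scale (of_real (1 / (\<omega> n + \<omega> (n - 1)))) (commutator (fock_A \<omega>) (fock_C \<omega>) (Phi n)) - 0 =
          fock_scale (of_real ((\<omega> n - \<omega> (n - 1)) / (\<omega> n + \<omega> (n - 1)))) (Phi n)"
        unfolding fock_commutator_A_C_Phi[OF assms(1) elim] by (rule poly_mapping_eqI) (simp add: lookup_minus)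
      then show ?case by (simp only: fock_norm_scale_Phi norm_of_real)
    qed
  qed
qed

theorem theorem6p6:
  fixes \<omega> \<alpha> :: "nat \<Rightarrow> real" and c :: real
  assumes "jacobi_sequence \<omega> \<alpha>"
    and "RAC2 \<omega> \<alpha>"
    and "\<not> RAC1 \<omega> \<alpha>"
    and "(\<lambda>n. (\<alpha> n - \<alpha> (n - 1)) / sqrt (\<omega> (n - 1) + \<omega> n)) \<longlonglongrightarrow> c"
  shows "\<forall>m::nat.
    (\<lambda>k. fock_inner ((normalized_X \<omega> \<alpha> k ^^ m) (Phi k)) (Phi k))
      \<longlonglongrightarrow> complex_of_real (\<integral>x. x ^ m \<partial>discrete_arcsine c)"
proof
  fix m
  interpret regular_jacobi \<omega> \<alpha> c
    by unfold_locales (use assms RAC2_imp_omega_lim in auto)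
  \<comment> \<open>The failure of (RAC1) enters here: \<open>c = 0\<close> would make
    \<open>AB - BA\<close> negligible as well.\<close>
  have "c \<noteq> 0" by (rule arcsine_parameter_nonzero[OF assms])
  \<comment> \<open>Pairing with \<open>Phi k\<close> reads off coordinate \<open>k\<close>, which
    is offset \<open>j = 0\<close>.\<close>
  from lookup_normalized_X_power_tendsto[OF this, of m 0]
  show "(\<lambda>k. fock_inner ((normalized_X \<omega> \<alpha> k ^^ m) (Phi k)) (Phi k))
      \<longlonglongrightarrow> complex_of_real (\<integral>x. x ^ m \<partial>discrete_arcsine c)"
    by (simp add: fock_inner_Phi_right integral_discrete_arcsine_power del: single_one)
qed

end
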